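(* Let $\mathcal{F}$ be the coassociative coalgebra with basis $a,b,c,d$ and coproduct $$\Delta a=a\otimes a+b\otimes c,\quad \Delta b=a\otimes b+b\otimes d,\quad \Delta c=d\otimes c+c\otimes a,\quad \Delta d=d\otimes d+c\otimes b.$$ The line-extension of the $(2,1)$-De Bruijn graph can be equipped with the coassociative coproduct associated with the coalgebra $\mathcal{F}$; that is, the vertices of the line-extension can be identified with $a,b,c,d$ in such a way that the line-extension is the geometric support of $(\mathcal{F},\Delta)$.
   Context: The field $k$ is $\mathbb{R}$ or $\mathbb{C}$. The $(2,1)$-De Bruijn graph is the directed graph with two vertices having exactly one arrow from $u$ to $v$ for every ordered pair of vertices $(u,v)$ (including loops). The line-extension $E(G)$ of a directed graph $G$ with vertex set $G_0$ and arrow set $G_1\subseteq G_0\times G_0$ is the directed graph with vertex set $G_1$, having an arrow from $(u,v)$ to $(u',v')$ if and only if $v=u'$. The geometric support of a coalgebra $(L,\Delta)$ with chosen basis $L_0$ is the directed graph with vertex set $L_0$ and arrow set the set of tensors $u\otimes v$ ($u,v\in L_0$) appearing with nonzero coefficient in the coproducts of basis elements; $u\otimes v$ is viewed as an arrow from $u$ to $v$. Graphs are considered up to isomorphism. *)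

theory Defs
  imports Complex_Main "HOL-Library.Poly_Mapping" "Graph_Theory.Graph_Theory"
begin

section \<open>Vector spaces with a chosen basis\<close>

text \<open>
  A \<open>'k\<close>-vector space with chosen basis \<open>'b\<close> is the space \<open>'b \<Rightarrow>\<^sub>0 'k\<close> of finitely supported
  functions; the basis vector belonging to \<open>u\<close> is \<open>basis_vec u\<close>. The tensor product of the spaces
  with bases \<open>'a\<close> and \<open>'b\<close> is the space with basis \<open>'a \<times> 'b\<close>, the pair \<open>(u, v)\<close> standing for
  the tensor of the basis vectors of \<open>u\<close> and \<open>v\<close>.
\<close>

definition scale :: "'k::field \<Rightarrow> ('b \<Rightarrow>\<^sub>0 'k) \<Rightarrow> ('b \<Rightarrow>\<^sub>0 'k)" where
  "scale c x = Poly_Mapping.map ((*) c) x"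

definition basis_vec :: "'b \<Rightarrow> ('b \<Rightarrow>\<^sub>0 'k::field)" where
  "basis_vec u = Poly_Mapping.single u 1"

definition tensor :: "('a \<Rightarrow>\<^sub>0 'k::field) \<Rightarrow> ('b \<Rightarrow>\<^sub>0 'k) \<Rightarrow> ('a \<times> 'b \<Rightarrow>\<^sub>0 'k)" (infixl \<open>\<otimes>\<close> 70) where
  "x \<otimes> y = (\<Sum>u\<in>Poly_Mapping.keys x. \<Sum>v\<in>Poly_Mapping.keys y.
     Poly_Mapping.single (u, v) (Poly_Mapping.lookup x u * Poly_Mapping.lookup y v))"

definition linear_extension :: "('b \<Rightarrow> ('c \<Rightarrow>\<^sub>0 'k::field)) \<Rightarrow> ('b \<Rightarrow>\<^sub>0 'k) \<Rightarrow> ('c \<Rightarrow>\<^sub>0 'k)" where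
  "linear_extension f x = (\<Sum>u\<in>Poly_Mapping.keys x. scale (Poly_Mapping.lookup x u) (f u))"

definition tensor_map ::
  "(('a \<Rightarrow>\<^sub>0 'k::field) \<Rightarrow> ('c \<Rightarrow>\<^sub>0 'k)) \<Rightarrow> (('b \<Rightarrow>\<^sub>0 'k) \<Rightarrow> ('d \<Rightarrow>\<^sub>0 'k)) \<Rightarrow>
   ('a \<times> 'b \<Rightarrow>\<^sub>0 'k) \<Rightarrow> ('c \<times> 'd \<Rightarrow>\<^sub>0 'k)" where
  "tensor_map f g = linear_extension (\<lambda>(u, v). f (basis_vec u) \<otimes> g (basis_vec v))"

definition tensor_assoc :: "(('a \<times> 'b) \<times> 'c \<Rightarrow>\<^sub>0 'k::field) \<Rightarrow> ('a \<times> ('b \<times> 'c) \<Rightarrow>\<^sub>0 'k)" where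
  "tensor_assoc = linear_extension (\<lambda>((u, v), w). basis_vec u \<otimes> (basis_vec v \<otimes> basis_vec w))"

lemma lookup_scale [simp]:
  "Poly_Mapping.lookup (scale c x) u = c * Poly_Mapping.lookup x u"
  unfolding scale_def by transfer (auto simp: when_def)

lemma vector_space_scale: "vector_space (scale :: 'k::field \<Rightarrow> ('b \<Rightarrow>\<^sub>0 'k) \<Rightarrow> _)"
  by unfold_locales (auto intro!: poly_mapping_eqI simp: lookup_add algebra_simps)


section \<open>Coalgebras and their geometric supports\<close>

text \<open>As usual for coassociativity alone, no counit is required.\<close>

definition coassociative_coalgebra :: "(('b \<Rightarrow>\<^sub>0 'k::field) \<Rightarrow> ('b \<times> 'b \<Rightarrow>\<^sub>0 'k)) \<Rightarrow> bool" where
  "coassociative_coalgebra \<Delta> \<longleftrightarrow>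
     Vector_Spaces.linear scale scale \<Delta> \<and>
     (\<forall>x. tensor_assoc (tensor_map \<Delta> id (\<Delta> x)) = tensor_map id \<Delta> (\<Delta> x))"

definition geometric_support ::
  "(('b \<Rightarrow>\<^sub>0 'k::field) \<Rightarrow> ('b \<times> 'b \<Rightarrow>\<^sub>0 'k)) \<Rightarrow> 'b pair_pre_digraph" where
  "geometric_support \<Delta> =
     \<lparr> pverts = UNIV,
       parcs = {(u, v). \<exists>w. Poly_Mapping.lookup (\<Delta> (basis_vec w)) (u, v) \<noteq> 0} \<rparr>"

datatype F_basis = Fa | Fb | Fc | Fd

primrec F_coproduct_basis :: "F_basis \<Rightarrow> (F_basis \<times> F_basis \<Rightarrow>\<^sub>0 'k::field)" where
  "F_coproduct_basis Fa = basis_vec Fa \<otimes> basis_vec Fa + basis_vec Fb \<otimes> basis_vec Fc"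
| "F_coproduct_basis Fb = basis_vec Fa \<otimes> basis_vec Fb + basis_vec Fb \<otimes> basis_vec Fd"
| "F_coproduct_basis Fc = basis_vec Fd \<otimes> basis_vec Fc + basis_vec Fc \<otimes> basis_vec Fa"
| "F_coproduct_basis Fd = basis_vec Fd \<otimes> basis_vec Fd + basis_vec Fc \<otimes> basis_vec Fb"

definition F_coproduct :: "(F_basis \<Rightarrow>\<^sub>0 'k::field) \<Rightarrow> (F_basis \<times> F_basis \<Rightarrow>\<^sub>0 'k)" where
  "F_coproduct = linear_extension F_coproduct_basis"


section \<open>Line-extensions and the De Bruijn graph\<close>

definition line_extension :: "'v pair_pre_digraph \<Rightarrow> ('v \<times> 'v) pair_pre_digraph" where
  "line_extension G =
     \<lparr> pverts = parcs G,
       parcs = {(e, e'). e \<in> parcs G \<and> e' \<in> parcs G \<and> snd e = fst e'} \<rparr>"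

definition de_bruijn_2_1 :: "nat pair_pre_digraph" where
  "de_bruijn_2_1 = \<lparr> pverts = {0, 1}, parcs = {0, 1} \<times> {0, 1} \<rparr>"

end

theory Submission
  imports Defs
begin

text \<open>
  The coalgebra \<open>\<F>\<close> is the \<open>2 \<times> 2\<close> comatrix coalgebra in disguise. Writing the basis as the matrix
  with rows \<open>a b\<close> and \<open>c d\<close>, and calling its entries \<open>e\<^sub>i\<^sub>j\<close> for \<open>i, j \<in> {0, 1}\<close>, all four formulas for
  the coproduct become the single formula
  \<open>\<Delta> e\<^sub>i\<^sub>j = (\<Sum>k. e\<^sub>i\<^sub>k \<otimes> e\<^sub>k\<^sub>j)\<close>.

  Now \<open>e\<^sub>i\<^sub>j\<close> names the arrow from \<open>i\<close> to \<open>j\<close> in the complete digraph with loops on \<open>{0, 1}\<close>, which is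
  the \<open>(2,1)\<close>-De Bruijn graph, and \<open>\<Delta>\<close> sends an arrow to the sum of its factorisations
  into two composable arrows. Two consequences hold over any field and for any finite vertex set \<open>I\<close>:

  \<^item> Both iterated coproducts of \<open>e\<^sub>i\<^sub>j\<close> are the sum of all \<open>e\<^sub>i\<^sub>k \<otimes> e\<^sub>k\<^sub>l \<otimes> e\<^sub>l\<^sub>j\<close>, only enumerated in
    different orders; this gives coassociativity (\<open>comatrix_coassociative\<close>).

  \<^item> A tensor \<open>u \<otimes> v\<close> of two arrows occurs in some coproduct exactly if \<open>u\<close> ends where \<open>v\<close>
    starts, since one can then take the coproduct of the arrow from the start of \<open>u\<close> to the end
    of \<open>v\<close>. Such pairs are the arrows of the line-extension (\<open>comatrix_support_iso\<close>).
\<close>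


section \<open>Linear maps on spaces with a chosen basis\<close>

lemma lookup_basis_vec:
  "Poly_Mapping.lookup (basis_vec u) v = (if u = v then 1 else 0)"
  by (simp add: basis_vec_def lookup_single when_def)

lemma lookup_linear_extension:
  assumes "finite A" "Poly_Mapping.keys x \<subseteq> A"
  shows "Poly_Mapping.lookup (linear_extension f x) w =
    (\<Sum>u\<in>A. Poly_Mapping.lookup x u * Poly_Mapping.lookup (f u) w)"
proof -
  have "Poly_Mapping.lookup (linear_extension f x) w =
      (\<Sum>u\<in>Poly_Mapping.keys x. Poly_Mapping.lookup x u * Poly_Mapping.lookup (f u) w)"
    by (simp add: linear_extension_def lookup_sum)
  also have "\<dots> = (\<Sum>u\<in>A. Poly_Mapping.lookup x u * Poly_Mapping.lookup (f u) w)"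
    using assms by (intro sum.mono_neutral_left) (auto simp: in_keys_iff)
  finally show ?thesis .
qed

lemma linear_linear_extension: "Vector_Spaces.linear scale scale (linear_extension f)"
proof -
  have "linear_extension f (x + y) = linear_extension f x + linear_extension f y" for x y
  proof (rule poly_mapping_eqI)
    fix w
    \<comment> \<open>The three sums range over different supports, so all are extended to a common finite set.\<close>
    let ?A = "Poly_Mapping.keys x \<union> Poly_Mapping.keys y"
    have "Poly_Mapping.keys (x + y) \<subseteq> ?A" by (rule Poly_Mapping.keys_add)
    then show "Poly_Mapping.lookup (linear_extension f (x + y)) w =
        Poly_Mapping.lookup (linear_extension f x + linear_extension f y) w"
      by (simp add: lookup_linear_extension[where A = ?A] lookup_add algebra_simps sum.distrib)
  qed
  moreover have "linear_extension f (scale c x) = scale c (linear_extension f x)" for c x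
  proof (rule poly_mapping_eqI)
    fix w
    have "Poly_Mapping.keys (scale c x) \<subseteq> Poly_Mapping.keys x" by (auto simp: in_keys_iff)
    then show "Poly_Mapping.lookup (linear_extension f (scale c x)) w =
        Poly_Mapping.lookup (scale c (linear_extension f x)) w"
      by (simp add: lookup_linear_extension[where A = "Poly_Mapping.keys x"] sum_distrib_left
          algebra_simps)
  qed
  ultimately show ?thesis
    by (simp add: Vector_Spaces.linear_iff vector_space_scale)
qed

lemma linear_extension_basis_vec: "linear_extension f (basis_vec u) = f u"
  by (rule poly_mapping_eqI)
    (simp add: lookup_linear_extension[where A = "{u}"] basis_vec_def)

lemma sum_scale_basis_vec:
  "(\<Sum>u\<in>Poly_Mapping.keys x. scale (Poly_Mapping.lookup x u) (basis_vec u)) = x"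
  by (rule poly_mapping_eqI)
    (simp add: lookup_sum lookup_basis_vec in_keys_iff if_distrib cong: if_cong)

lemma linear_sum_scale:
  assumes "Vector_Spaces.linear scale scale f"
  shows "f (\<Sum>k\<in>K. x k) = (\<Sum>k\<in>K. f (x k))"
proof -
  interpret f: Vector_Spaces.linear scale scale f by (rule assms)
  show ?thesis by (rule f.sum)
qed

lemma linear_eq_if_eq_on_basis:
  assumes f: "Vector_Spaces.linear scale scale f" and g: "Vector_Spaces.linear scale scale g"
    and eq: "\<And>u. f (basis_vec u) = g (basis_vec u)"
  shows "f x = g x"
proof -
  interpret f: Vector_Spaces.linear scale scale f by (rule f)
  interpret g: Vector_Spaces.linear scale scale g by (rule g)
  let ?s = "\<Sum>u\<in>Poly_Mapping.keys x. scale (Poly_Mapping.lookup x u) (basis_vec u)"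
  have "f ?s = g ?s" by (simp only: f.sum g.sum f.scale g.scale eq)
  then show ?thesis by (simp only: sum_scale_basis_vec)
qed


section \<open>Tensor products\<close>

lemma lookup_tensor:
  "Poly_Mapping.lookup (x \<otimes> y) (u, v) = Poly_Mapping.lookup x u * Poly_Mapping.lookup y v"
proof -
  have inner: "(\<Sum>v'\<in>Poly_Mapping.keys y. Poly_Mapping.lookup (Poly_Mapping.single (u', v')
        (Poly_Mapping.lookup x u' * Poly_Mapping.lookup y v')) (u, v)) =
      (if u' = u then Poly_Mapping.lookup x u' * Poly_Mapping.lookup y v else 0)" for u'
    by (cases "u' = u") (auto simp: lookup_single when_def in_keys_iff)
  show ?thesis
    by (simp add: tensor_def lookup_sum inner in_keys_iff)
qed

lemma tensor_basis_vec: "basis_vec u \<otimes> basis_vec v = basis_vec (u, v)"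
proof (rule poly_mapping_eqI)
  fix p
  show "Poly_Mapping.lookup (basis_vec u \<otimes> basis_vec v) p =
      Poly_Mapping.lookup (basis_vec (u, v)) p"
    by (cases p) (simp add: lookup_tensor lookup_basis_vec)
qed

lemma tensor_sum_left: "(\<Sum>k\<in>K. f k) \<otimes> y = (\<Sum>k\<in>K. f k \<otimes> y)"
proof (rule poly_mapping_eqI)
  fix p
  show "Poly_Mapping.lookup ((\<Sum>k\<in>K. f k) \<otimes> y) p = Poly_Mapping.lookup (\<Sum>k\<in>K. f k \<otimes> y) p"
    by (cases p) (simp add: lookup_tensor lookup_sum sum_distrib_right)
qed

lemma tensor_sum_right: "x \<otimes> (\<Sum>k\<in>K. f k) = (\<Sum>k\<in>K. x \<otimes> f k)"
proof (rule poly_mapping_eqI)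
  fix p
  show "Poly_Mapping.lookup (x \<otimes> (\<Sum>k\<in>K. f k)) p = Poly_Mapping.lookup (\<Sum>k\<in>K. x \<otimes> f k) p"
    by (cases p) (simp add: lookup_tensor lookup_sum sum_distrib_left)
qed

lemma linear_tensor_map: "Vector_Spaces.linear scale scale (tensor_map f g)"
  unfolding tensor_map_def by (rule linear_linear_extension)

lemma tensor_map_basis_vec:
  "tensor_map f g (basis_vec (u, v)) = f (basis_vec u) \<otimes> g (basis_vec v)"
  by (simp add: tensor_map_def linear_extension_basis_vec)

lemma linear_tensor_assoc: "Vector_Spaces.linear scale scale tensor_assoc"
  unfolding tensor_assoc_def by (rule linear_linear_extension)

lemma tensor_assoc_basis_vec: "tensor_assoc (basis_vec ((u, v), w)) = basis_vec (u, (v, w))"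
  by (simp add: tensor_assoc_def linear_extension_basis_vec tensor_basis_vec)


section \<open>Comatrix coalgebras\<close>

text \<open>
  Applied to \<open>e\<^sub>i\<^sub>j\<close>, the left iterated coproduct splits at \<open>l\<close> and then splits \<open>e\<^sub>i\<^sub>l\<close> at \<open>k\<close>; the right
  one splits at \<open>k\<close> and then splits \<open>e\<^sub>k\<^sub>j\<close> at \<open>l\<close>. Both therefore sum over the paths \<open>i, k, l, j\<close>,
  and the two results differ by an exchange of the two summations.
\<close>

lemma comatrix_coassociative:
  fixes \<Delta> :: "('b \<Rightarrow>\<^sub>0 'k::field) \<Rightarrow> ('b \<times> 'b \<Rightarrow>\<^sub>0 'k)"
  assumes linear: "Vector_Spaces.linear scale scale \<Delta>"
    and surj: "e ` (I \<times> I) = UNIV"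
    and comatrix: "\<And>i j. i \<in> I \<Longrightarrow> j \<in> I \<Longrightarrow>
      \<Delta> (basis_vec (e (i, j))) = (\<Sum>k\<in>I. basis_vec (e (i, k), e (k, j)))"
  shows "coassociative_coalgebra \<Delta>"
proof -
  have on_basis: "tensor_assoc (tensor_map \<Delta> id (\<Delta> (basis_vec u))) =
      tensor_map id \<Delta> (\<Delta> (basis_vec u))" for u
  proof -
    obtain i j where ij: "i \<in> I" "j \<in> I" "u = e (i, j)" using surj by blast
    have "tensor_assoc (tensor_map \<Delta> id (\<Delta> (basis_vec u))) =
        (\<Sum>l\<in>I. \<Sum>k\<in>I. basis_vec (e (i, k), (e (k, l), e (l, j))))"
      using ij by (simp add: comatrix linear_sum_scale[OF linear_tensor_map]
          linear_sum_scale[OF linear_tensor_assoc] tensor_map_basis_vec tensor_sum_left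
          tensor_basis_vec tensor_assoc_basis_vec)
    also have "\<dots> = (\<Sum>k\<in>I. \<Sum>l\<in>I. basis_vec (e (i, k), (e (k, l), e (l, j))))"
      by (rule sum.swap)
    also have "\<dots> = tensor_map id \<Delta> (\<Delta> (basis_vec u))"
      using ij by (simp add: comatrix linear_sum_scale[OF linear_tensor_map]
          tensor_map_basis_vec tensor_sum_right tensor_basis_vec)
    finally show ?thesis .
  qed
  have left: "Vector_Spaces.linear scale scale (tensor_assoc \<circ> (tensor_map \<Delta> id \<circ> \<Delta>))"
    by (rule Vector_Spaces.linear_compose[OF
          Vector_Spaces.linear_compose[OF linear linear_tensor_map] linear_tensor_assoc])
  have right: "Vector_Spaces.linear scale scale (tensor_map id \<Delta> \<circ> \<Delta>)"
    by (rule Vector_Spaces.linear_compose[OF linear linear_tensor_map])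
  have "tensor_assoc (tensor_map \<Delta> id (\<Delta> x)) = tensor_map id \<Delta> (\<Delta> x)" for x
    using linear_eq_if_eq_on_basis[OF left right, of x] on_basis by simp
  with linear show ?thesis by (simp add: coassociative_coalgebra_def)
qed

text \<open>
  Injectivity of the naming \<open>e\<close> keeps the terms of a single coproduct distinct, so that every
  composable pair appears with coefficient \<open>1\<close> and no cancellation can occur, whatever the
  characteristic.
\<close>

lemma comatrix_support_arcs:
  fixes \<Delta> :: "('b \<Rightarrow>\<^sub>0 'k::field) \<Rightarrow> ('b \<times> 'b \<Rightarrow>\<^sub>0 'k)"
  assumes fin: "finite I"
    and bij: "bij_betw e (I \<times> I) UNIV"
    and comatrix: "\<And>i j. i \<in> I \<Longrightarrow> j \<in> I \<Longrightarrow>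
      \<Delta> (basis_vec (e (i, j))) = (\<Sum>k\<in>I. basis_vec (e (i, k), e (k, j)))"
  shows "parcs (geometric_support \<Delta>) =
    {(e (i, k), e (k, j)) | i k j. i \<in> I \<and> k \<in> I \<and> j \<in> I}"
proof (intro equalityI subsetI)
  fix p assume "p \<in> parcs (geometric_support \<Delta>)"
  then obtain w where "Poly_Mapping.lookup (\<Delta> (basis_vec w)) p \<noteq> 0"
    by (auto simp: geometric_support_def)
  moreover obtain i j where ij: "i \<in> I" "j \<in> I" "w = e (i, j)"
    using bij by (auto simp: bij_betw_def) blast
  ultimately have "(\<Sum>k\<in>I. Poly_Mapping.lookup (basis_vec (e (i, k), e (k, j)) :: _ \<Rightarrow>\<^sub>0 'k) p) \<noteq> 0"
    by (simp add: comatrix lookup_sum)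
  then obtain k where "k \<in> I" "p = (e (i, k), e (k, j))"
    by (elim sum.not_neutral_contains_not_neutral) (auto simp: lookup_basis_vec split: if_splits)
  with ij show "p \<in> {(e (i, k), e (k, j)) | i k j. i \<in> I \<and> k \<in> I \<and> j \<in> I}" by blast
next
  fix p assume "p \<in> {(e (i, k), e (k, j)) | i k j. i \<in> I \<and> k \<in> I \<and> j \<in> I}"
  then obtain i k j where I: "i \<in> I" "k \<in> I" "j \<in> I" and p: "p = (e (i, k), e (k, j))"
    by blast
  have "e (i, k') = e (i, k) \<longleftrightarrow> k' = k" if "k' \<in> I" for k'
    using bij I that by (auto simp: bij_betw_def dest: inj_onD)
  then have "Poly_Mapping.lookup (\<Delta> (basis_vec (e (i, j)))) p = (\<Sum>k'\<in>I. if k' = k then 1 else 0)"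
    using I by (auto simp: comatrix p lookup_sum lookup_basis_vec intro!: sum.cong)
  also have "\<dots> = 1" using fin I by simp
  finally have "Poly_Mapping.lookup (\<Delta> (basis_vec (e (i, j)))) p \<noteq> 0" by simp
  then show "p \<in> parcs (geometric_support \<Delta>)"
    by (auto simp: geometric_support_def p)
qed

lemma digraph_iso_with_projI:
  assumes wf: "parcs G \<subseteq> pverts G \<times> pverts G"
    and bij: "bij_betw f (pverts G) (pverts H)"
    and arcs: "map_prod f f ` parcs G = parcs H"
  shows "digraph_iso (with_proj G) (with_proj H)"
proof -
  let ?h = "\<lparr>iso_verts = f, iso_arcs = map_prod f f, iso_head = snd, iso_tail = fst\<rparr>"
  have "wf_digraph (with_proj G)" using wf by unfold_locales auto
  moreover have "inj_on (map_prod f f) (parcs G)"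
    using wf map_prod_inj_on[of f "pverts G" f "pverts G"] bij
    by (auto simp: bij_betw_def intro: inj_on_subset)
  ultimately have "pre_digraph.digraph_isomorphism (with_proj G) ?h"
    using bij by (simp add: pre_digraph.digraph_isomorphism_def bij_betw_def)
  moreover have "with_proj H = app_iso ?h (with_proj G)"
    using bij arcs by (simp add: app_iso_def with_proj_def bij_betw_def)
  ultimately show ?thesis unfolding digraph_iso_def by blast
qed

lemma comatrix_support_iso:
  fixes \<Delta> :: "('b \<Rightarrow>\<^sub>0 'k::field) \<Rightarrow> ('b \<times> 'b \<Rightarrow>\<^sub>0 'k)"
  assumes fin: "finite I"
    and bij: "bij_betw e (I \<times> I) UNIV"
    and comatrix: "\<And>i j. i \<in> I \<Longrightarrow> j \<in> I \<Longrightarrow>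
      \<Delta> (basis_vec (e (i, j))) = (\<Sum>k\<in>I. basis_vec (e (i, k), e (k, j)))"
  shows "digraph_iso (with_proj (line_extension \<lparr>pverts = I, parcs = I \<times> I\<rparr>))
    (with_proj (geometric_support \<Delta>))"
proof (rule digraph_iso_with_projI[where f = e])
  let ?L = "line_extension \<lparr>pverts = I, parcs = I \<times> I\<rparr>"
  show "parcs ?L \<subseteq> pverts ?L \<times> pverts ?L" by (auto simp: line_extension_def)
  show "bij_betw e (pverts ?L) (pverts (geometric_support \<Delta>))"
    using bij by (simp add: line_extension_def geometric_support_def)
  have "map_prod e e ` parcs ?L = {(e (i, k), e (k, j)) | i k j. i \<in> I \<and> k \<in> I \<and> j \<in> I}"
    by (auto simp: line_extension_def image_iff) force
  also have "\<dots> = parcs (geometric_support \<Delta>)"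
    using fin bij comatrix by (rule comatrix_support_arcs[symmetric])
  finally show "map_prod e e ` parcs ?L = parcs (geometric_support \<Delta>)" .
qed


section \<open>The coalgebra with basis \<open>a, b, c, d\<close> as a comatrix coalgebra\<close>

text \<open>The entry \<open>e\<^sub>i\<^sub>j\<close> of the matrix with rows \<open>a b\<close> and \<open>c d\<close>.\<close>

definition F_entry :: "nat \<times> nat \<Rightarrow> F_basis" where
  "F_entry = (\<lambda>(i, j). if i = 0 then (if j = 0 then Fa else Fb) else (if j = 0 then Fc else Fd))"

lemma bij_betw_F_entry: "bij_betw F_entry ({0, 1} \<times> {0, 1}) UNIV"
proof -
  have "u \<in> F_entry ` ({0, 1} \<times> {0, 1})" for u
    by (cases u) (auto simp: F_entry_def)
  then show ?thesis
    by (auto simp: bij_betw_def inj_on_def F_entry_def split: if_splits)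
qed

lemma F_coproduct_comatrix:
  assumes "i \<in> {0, 1}" "j \<in> {0, 1}"
  shows "F_coproduct (basis_vec (F_entry (i, j))) =
    (\<Sum>k\<in>{0, 1}. basis_vec (F_entry (i, k), F_entry (k, j)))"
  using assms
  by (auto simp: F_coproduct_def linear_extension_basis_vec F_entry_def tensor_basis_vec
      add.commute)

lemma F_coproduct_on_line_extension:
  fixes \<Delta> :: "(F_basis \<Rightarrow>\<^sub>0 'k::field) \<Rightarrow> (F_basis \<times> F_basis \<Rightarrow>\<^sub>0 'k)"
  defines "\<Delta> \<equiv> F_coproduct"
  shows "coassociative_coalgebra \<Delta> \<and>
    digraph_iso (with_proj (line_extension de_bruijn_2_1)) (with_proj (geometric_support \<Delta>))"
proof
  have "Vector_Spaces.linear scale scale \<Delta>"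
    unfolding \<Delta>_def F_coproduct_def by (rule linear_linear_extension)
  then show "coassociative_coalgebra \<Delta>"
    using bij_betw_F_entry F_coproduct_comatrix unfolding \<Delta>_def
    by (intro comatrix_coassociative[where I = "{0, 1}" and e = F_entry])
      (auto simp only: bij_betw_def)
  show "digraph_iso (with_proj (line_extension de_bruijn_2_1)) (with_proj (geometric_support \<Delta>))"
    unfolding \<Delta>_def de_bruijn_2_1_def
    by (rule comatrix_support_iso[OF _ bij_betw_F_entry F_coproduct_comatrix]) simp_all
qed

theorem corollary2p11:
  shows "(coassociative_coalgebra
            (F_coproduct :: (F_basis \<Rightarrow>\<^sub>0 real) \<Rightarrow> (F_basis \<times> F_basis \<Rightarrow>\<^sub>0 real)) \<and>
          digraph_iso (with_proj (line_extension de_bruijn_2_1))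
            (with_proj (geometric_support
              (F_coproduct :: (F_basis \<Rightarrow>\<^sub>0 real) \<Rightarrow> (F_basis \<times> F_basis \<Rightarrow>\<^sub>0 real)))))
       \<and> (coassociative_coalgebra
            (F_coproduct :: (F_basis \<Rightarrow>\<^sub>0 complex) \<Rightarrow> (F_basis \<times> F_basis \<Rightarrow>\<^sub>0 complex)) \<and>
          digraph_iso (with_proj (line_extension de_bruijn_2_1))
            (with_proj (geometric_support
              (F_coproduct :: (F_basis \<Rightarrow>\<^sub>0 complex) \<Rightarrow> (F_basis \<times> F_basis \<Rightarrow>\<^sub>0 complex)))))"
  by (intro conjI F_coproduct_on_line_extension[THEN conjunct1]
      F_coproduct_on_line_extension[THEN conjunct2])

end
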